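(* Let $(p_t^{\delta})_{t\ge0}$ ($\delta>0$) be the transition function on $\mathbb{R}^n\times\mathbb{R}^d$ of the slow-fast system $(X_t^\delta,Y_t^\delta)_{t\ge 0}$, let $(\bar p_t)_{t\ge0}$ be the transition function on $\mathbb{R}^n$ of the averaged process $(\bar X_t)_{t\ge 0}$ (both described in the context), and let $\mathbf{dist}$ be a distance between probability measures on $\mathbb{R}^n$. Assume: (1) (Contractivity for the limit process) There exist $\lambda>0$ and $C<\infty$ such that for all probability measures $\nu,\eta$ on $\mathbb{R}^n$ and $t>0$, $\mathbf{dist}(\nu\bar p_t,\eta\bar p_t)\le Ce^{-\lambda t}\,\mathbf{dist}(\nu,\eta)$. (2) (Finite time convergence) There exist a finite time $\tau>0$, a constant $\alpha>0$ and a function $\mathbf{M}:\mathcal{P}(\mathbb{R}^n\times\mathbb{R}^d)\to[0,\infty)$ such that for all $\nu\in\mathcal{P}(\mathbb{R}^n\times\mathbb{R}^d)$ and any $\delta>0$, $\sup_{t\in[0,\tau]}\mathbf{dist}(\nu^x\bar p_t,(\nu p_t^{\delta})^x)\le\delta^{\alpha}\mathbf{M}(\nu)$. (3) (Uniform bound for the coupled process) For all $\nu\in\mathcal{P}(\mathbb{R}^n\times\mathbb{R}^d)$ there exists a constant $\mathbf{C}(\nu)<\infty$ such that for all $\delta>0$, $\sup_{t\ge0}\mathbf{M}(\nu p_t^{\delta})\le\mathbf{C}(\nu)$. Let $\nu$ be a probability measure on $\mathbb{R}^n\times\mathbb{R}^d$. Then there exists a constant $\tilde{\mathbf{C}}>0$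 such that for all $t\ge0$ and $\delta>0$, $$\mathbf{dist}(\nu^x\bar p_t,(\nu p_t^{\delta})^x)\le\tilde{\mathbf{C}}\,\delta^{\alpha}.$$ The constant $\tilde{\mathbf{C}}$ depends on the initial distribution $\nu$ and on the constants $C$, $\lambda$ and $\tau$ above.
   Context: $\mathcal{P}(E)$ denotes the probability measures on $E$. For a probability measure $\nu$ on $\mathbb{R}^n\times\mathbb{R}^d$, $\nu^x$ denotes its marginal on $\mathbb{R}^n$. Slow-fast system: for $\delta>0$, $$\mathrm{d}X_t^\delta=b(X_t^\delta,Y_t^\delta)\,\mathrm{d}t+\sigma(X_t^\delta,Y_t^\delta)\,\mathrm{d}W_t,\qquad \mathrm{d}Y_t^\delta=\tfrac1\delta g(X_t^\delta,Y_t^\delta)\,\mathrm{d}t+\tfrac1{\sqrt\delta}a(X_t^\delta,Y_t^\delta)\,\mathrm{d}B_t,$$ with values in $\mathbb{R}^n\times\mathbb{R}^d$, where $W$ and $B$ are independent standard Brownian motions of dimension $n$ and $d$. For fixed $x\in\mathbb{R}^n$ the frozen process $\mathrm{d}Y_t=g(x,Y_t)\,\mathrm{d}t+a(x,Y_t)\,\mathrm{d}B_t$ is assumed to have a unique invariant measure $\mu_\infty(x;\mathrm{d}y)$. The averaged process on $\mathbb{R}^n$ is $\mathrm{d}\bar X_t=\bar b(\bar X_t)\,\mathrm{d}t+\bar\sigma(\bar X_t)\,\mathrm{d}W_t$, with $\bar b(x)=\int_{\mathbb{R}^d}b(x,y)\,\mu_\infty(x;\mathrm{d}y)$ and $\bar\sigma(x)=\int_{\mathbb{R}^d}\sigma(x,y)\,\mu_\infty(x;\mathrm{d}y)$.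 Both are assumed to define time-homogeneous Markov processes; $\nu p_t^\delta$ (resp. $\nu\bar p_t$) is the law at time $t$ of the slow-fast (resp. averaged) process with initial law $\nu$, and the semigroup properties $\nu p_s^\delta p_t^\delta=\nu p_{s+t}^\delta$ and $\nu\bar p_s\bar p_t=\nu\bar p_{s+t}$ hold. *)

theory Defs
  imports "HOL-Probability.Probability"
begin

text \<open>
  Laws and kernels live in the Giry monad:
  \<open>space (prob_algebra borel)\<close> is the set of Borel probability measures, a Markov kernel is a
  measurable map into \<open>prob_algebra borel\<close>, and the action \<open>\<nu> p\<^sub>t\<close> of a kernel on an
  initial law is \<open>\<nu> \<bind> p t\<close>.
\<close>

abbreviation prob_measures :: "'e::topological_space measure set" where
  "prob_measures \<equiv> space (prob_algebra borel)"

definition marginal_x :: "('x::topological_space \<times> 'y::topological_space) measure \<Rightarrow> 'x measure" where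
  "marginal_x \<nu> = distr \<nu> borel fst"

definition transition_function :: "(real \<Rightarrow> 'e::topological_space \<Rightarrow> 'e measure) \<Rightarrow> bool" where
  "transition_function p \<longleftrightarrow>
     (\<forall>t\<ge>0. p t \<in> borel \<rightarrow>\<^sub>M prob_algebra borel) \<and>
     (\<forall>z. p 0 z = return borel z) \<and>
     (\<forall>s\<ge>0. \<forall>t\<ge>0. \<forall>z. p s z \<bind> p t = p (s + t) z)"


section \<open>Stochastic differential equations\<close>

text \<open>
  Processes and filtrations are indexed by all of \<open>real\<close>; only times \<open>t \<ge> 0\<close> matter (a filtration
  on \<open>[0, \<infinity>)\<close> is extended by \<open>F t = F 0\<close> for \<open>t < 0\<close>).
\<close>

definition filtered_prob_space :: "'w measure \<Rightarrow> (real \<Rightarrow> 'w measure) \<Rightarrow> bool" where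
  "filtered_prob_space \<Omega> F \<longleftrightarrow>
     prob_space \<Omega> \<and> filtration (space \<Omega>) F \<and> (\<forall>t. subalgebra \<Omega> (F t))"

definition continuous_adapted ::
    "'w measure \<Rightarrow> (real \<Rightarrow> 'w measure) \<Rightarrow> (real \<Rightarrow> 'w \<Rightarrow> 'e::topological_space) \<Rightarrow> bool" where
  "continuous_adapted \<Omega> F Z \<longleftrightarrow>
     (\<forall>t\<ge>0. Z t \<in> borel_measurable (F t)) \<and>
     (\<forall>\<omega>\<in>space \<Omega>. continuous_on {0..} (\<lambda>t. Z t \<omega>))"

definition progressively_measurable ::
    "(real \<Rightarrow> 'w measure) \<Rightarrow> (real \<Rightarrow> 'w \<Rightarrow> 'e::topological_space) \<Rightarrow> bool" where
  "progressively_measurable F H \<longleftrightarrow>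
     (\<forall>T\<ge>0. (\<lambda>(s, \<omega>). H s \<omega>) \<in> borel_measurable (restrict_space borel {0..T} \<Otimes>\<^sub>M F T))"

definition brownian_motion ::
    "'w measure \<Rightarrow> (real \<Rightarrow> 'w measure) \<Rightarrow> (real \<Rightarrow> 'w \<Rightarrow> real ^ 'm) \<Rightarrow> bool" where
  "brownian_motion \<Omega> F W \<longleftrightarrow>
     continuous_adapted \<Omega> F W \<and>
     (AE \<omega> in \<Omega>. W 0 \<omega> = 0) \<and>
     (\<forall>s t. 0 \<le> s \<and> s < t \<longrightarrow>
        distributed \<Omega> lborel (\<lambda>\<omega>. W t \<omega> - W s \<omega>)
          (\<lambda>z. ennreal (\<Prod>i\<in>UNIV. normal_density 0 (sqrt (t - s)) (z $ i))) \<and>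
        prob_space.indep_set \<Omega> (sets (F s))
          {(\<lambda>\<omega>. W t \<omega> - W s \<omega>) -` A \<inter> space \<Omega> |A. A \<in> sets borel})"

definition independent_processes ::
    "'w measure \<Rightarrow> (real \<Rightarrow> 'w \<Rightarrow> 'e::topological_space) \<Rightarrow> (real \<Rightarrow> 'w \<Rightarrow> 'f::topological_space) \<Rightarrow> bool"
  where
  "independent_processes \<Omega> W B \<longleftrightarrow>
     prob_space.indep_set \<Omega>
       (sets (vimage_algebra (space \<Omega>) (\<lambda>\<omega>. \<lambda>t\<in>{0..}. W t \<omega>) (PiM {0..} (\<lambda>_. borel))))
       (sets (vimage_algebra (space \<Omega>) (\<lambda>\<omega>. \<lambda>t\<in>{0..}. B t \<omega>) (PiM {0..} (\<lambda>_. borel))))"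

text \<open>
  The simple integrand \<open>\<Sum>i<N. \<xi> i * indicator {r i <.. r (i+1)}\<close> with bounded matrix-valued
  \<open>\<xi> i\<close>, measurable with respect to \<open>F (r i)\<close>, and its elementary integral.
\<close>

definition simple_integrand ::
    "'w measure \<Rightarrow> (real \<Rightarrow> 'w measure) \<Rightarrow> (nat \<Rightarrow> real) \<Rightarrow> (nat \<Rightarrow> 'w \<Rightarrow> real ^ 'm ^ 'k) \<Rightarrow> bool"
  where
  "simple_integrand \<Omega> F r \<xi> \<longleftrightarrow>
     0 \<le> r 0 \<and> mono r \<and>
     (\<forall>i. \<xi> i \<in> borel_measurable (F (r i)) \<and> (\<exists>K. \<forall>\<omega>\<in>space \<Omega>. norm (\<xi> i \<omega>) \<le> K))"

definition simple_process ::
    "nat \<Rightarrow> (nat \<Rightarrow> real) \<Rightarrow> (nat \<Rightarrow> 'w \<Rightarrow> real ^ 'm ^ 'k) \<Rightarrow> real \<Rightarrow> 'w \<Rightarrow> real ^ 'm ^ 'k" where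
  "simple_process N r \<xi> s \<omega> = (\<Sum>i<N. indicator {r i<..r (Suc i)} s *\<^sub>R \<xi> i \<omega>)"

definition simple_integral ::
    "nat \<Rightarrow> (nat \<Rightarrow> real) \<Rightarrow> (nat \<Rightarrow> 'w \<Rightarrow> real ^ 'm ^ 'k) \<Rightarrow> (real \<Rightarrow> 'w \<Rightarrow> real ^ 'm) \<Rightarrow>
      real \<Rightarrow> 'w \<Rightarrow> real ^ 'k" where
  "simple_integral N r \<xi> W t \<omega> =
     (\<Sum>i<N. \<xi> i \<omega> *v (W (min t (r (Suc i))) \<omega> - W (min t (r i)) \<omega>))"

definition tendsto_zero_in_probability :: "'w measure \<Rightarrow> (nat \<Rightarrow> 'w \<Rightarrow> ennreal) \<Rightarrow> bool" where
  "tendsto_zero_in_probability \<Omega> E \<longleftrightarrow>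
     (\<forall>\<epsilon>>0. (\<lambda>k. measure \<Omega> {\<omega>\<in>space \<Omega>. ennreal \<epsilon> < E k \<omega>}) \<longlonglongrightarrow> 0)"

text \<open>
  \<open>I t\<close> is the Ito integral \<open>\<integral>\<^sub>0\<^sup>t H dW\<close> of the matrix-valued integrand \<open>H\<close>, i.e. the limit in
  probability of elementary integrals, in its continuous version; this determines \<open>I\<close> up to
  indistinguishability. The norm on matrices is the Frobenius norm.
\<close>

definition has_ito_integral ::
    "'w measure \<Rightarrow> (real \<Rightarrow> 'w measure) \<Rightarrow> (real \<Rightarrow> 'w \<Rightarrow> real ^ 'm) \<Rightarrow>
      (real \<Rightarrow> 'w \<Rightarrow> real ^ 'm ^ 'k) \<Rightarrow> (real \<Rightarrow> 'w \<Rightarrow> real ^ 'k) \<Rightarrow> bool" where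
  "has_ito_integral \<Omega> F W H I \<longleftrightarrow>
     progressively_measurable F H \<and>
     (\<forall>t\<ge>0. AE \<omega> in \<Omega>. (\<integral>\<^sup>+s\<in>{0..t}. ennreal ((norm (H s \<omega>))\<^sup>2) \<partial>lborel) < \<infinity>) \<and>
     (\<forall>t\<ge>0. I t \<in> borel_measurable \<Omega>) \<and>
     (\<forall>\<omega>\<in>space \<Omega>. continuous_on {0..} (\<lambda>t. I t \<omega>)) \<and>
     (\<exists>N r \<xi>. (\<forall>k. simple_integrand \<Omega> F (r k) (\<xi> k)) \<and>
        (\<forall>t\<ge>0.
           tendsto_zero_in_probability \<Omega> (\<lambda>k \<omega>. \<integral>\<^sup>+s\<in>{0..t}.
             ennreal ((norm (simple_process (N k) (r k) (\<xi> k) s \<omega> - H s \<omega>))\<^sup>2) \<partial>lborel) \<and>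
           tendsto_zero_in_probability \<Omega> (\<lambda>k \<omega>.
             ennreal (norm (simple_integral (N k) (r k) (\<xi> k) W t \<omega> - I t \<omega>)))))"

text \<open>\<open>dZ\<^sub>t = \<beta>\<^sub>t dt + S\<^sub>t dW\<^sub>t\<close>, understood in integrated form.\<close>

definition ito_differential ::
    "'w measure \<Rightarrow> (real \<Rightarrow> 'w measure) \<Rightarrow> (real \<Rightarrow> 'w \<Rightarrow> real ^ 'm) \<Rightarrow>
      (real \<Rightarrow> 'w \<Rightarrow> real ^ 'k) \<Rightarrow> (real \<Rightarrow> 'w \<Rightarrow> real ^ 'k) \<Rightarrow> (real \<Rightarrow> 'w \<Rightarrow> real ^ 'm ^ 'k) \<Rightarrow> bool"
  where
  "ito_differential \<Omega> F W Z \<beta> S \<longleftrightarrow>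
     continuous_adapted \<Omega> F Z \<and> progressively_measurable F \<beta> \<and>
     (\<exists>I. has_ito_integral \<Omega> F W S I \<and>
        (AE \<omega> in \<Omega>. \<forall>t\<ge>0.
           set_integrable lborel {0..t} (\<lambda>s. \<beta> s \<omega>) \<and>
           Z t \<omega> = Z 0 \<omega> + (LINT s:{0..t}|lborel. \<beta> s \<omega>) + I t \<omega>))"

text \<open>
  \<open>Z\<close> has initial law \<open>\<nu>\<close>, law \<open>\<nu> p\<^sub>t\<close> at time \<open>t\<close>, and is a time-homogeneous Markov process with
  respect to \<open>F\<close> with transition function \<open>p\<close>.
\<close>

definition markov_with ::
    "'w measure \<Rightarrow> (real \<Rightarrow> 'w measure) \<Rightarrow> (real \<Rightarrow> 'w \<Rightarrow> 'e::topological_space) \<Rightarrow>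
      (real \<Rightarrow> 'e \<Rightarrow> 'e measure) \<Rightarrow> 'e measure \<Rightarrow> bool" where
  "markov_with \<Omega> F Z p \<nu> \<longleftrightarrow>
     distr \<Omega> borel (Z 0) = \<nu> \<and>
     (\<forall>t\<ge>0. distr \<Omega> borel (Z t) = \<nu> \<bind> p t) \<and>
     (\<forall>s\<ge>0. \<forall>t\<ge>0. \<forall>A\<in>sets borel. AE \<omega> in \<Omega>.
        real_cond_exp \<Omega> (F s) (\<lambda>\<omega>'. indicator A (Z (s + t) \<omega>')) \<omega> = measure (p t (Z s \<omega>)) A)"


section \<open>The slow-fast, frozen and averaged processes\<close>

text \<open>
  \<open>p\<close> is the transition function of the SDE \<open>dZ = \<beta>(Z) dt + S(Z) dW\<close>. The argument
  \<open>TYPE('w)\<close> is the type of elementary outcomes of the probability spaces carrying the solutions;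
  the space and the driving noise may depend on the initial law.
\<close>

definition sde_transition_function ::
    "'w itself \<Rightarrow> (real ^ 'k \<Rightarrow> real ^ 'k) \<Rightarrow> (real ^ 'k \<Rightarrow> real ^ 'k ^ 'k) \<Rightarrow>
      (real \<Rightarrow> real ^ 'k \<Rightarrow> (real ^ 'k) measure) \<Rightarrow> bool" where
  "sde_transition_function (_::'w itself) \<beta> S p \<longleftrightarrow>
     transition_function p \<and>
     (\<forall>\<nu>\<in>prob_measures. \<exists>(\<Omega> :: 'w measure) F W Z.
        filtered_prob_space \<Omega> F \<and> brownian_motion \<Omega> F W \<and>
        ito_differential \<Omega> F W Z (\<lambda>t \<omega>. \<beta> (Z t \<omega>)) (\<lambda>t \<omega>. S (Z t \<omega>)) \<and>
        markov_with \<Omega> F Z p \<nu>)"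

definition slow_fast_transition_function ::
    "'w itself \<Rightarrow>
      (real ^ 'n \<Rightarrow> real ^ 'd \<Rightarrow> real ^ 'n) \<Rightarrow> (real ^ 'n \<Rightarrow> real ^ 'd \<Rightarrow> real ^ 'n ^ 'n) \<Rightarrow>
      (real ^ 'n \<Rightarrow> real ^ 'd \<Rightarrow> real ^ 'd) \<Rightarrow> (real ^ 'n \<Rightarrow> real ^ 'd \<Rightarrow> real ^ 'd ^ 'd) \<Rightarrow>
      real \<Rightarrow> (real \<Rightarrow> (real ^ 'n) \<times> (real ^ 'd) \<Rightarrow> ((real ^ 'n) \<times> (real ^ 'd)) measure) \<Rightarrow> bool" where
  "slow_fast_transition_function (_::'w itself) b \<sigma> g a \<delta> p \<longleftrightarrow>
     transition_function p \<and>
     (\<forall>\<nu>\<in>prob_measures. \<exists>(\<Omega> :: 'w measure) F W B X Y.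
        filtered_prob_space \<Omega> F \<and>
        brownian_motion \<Omega> F W \<and> brownian_motion \<Omega> F B \<and> independent_processes \<Omega> W B \<and>
        ito_differential \<Omega> F W X
          (\<lambda>t \<omega>. b (X t \<omega>) (Y t \<omega>)) (\<lambda>t \<omega>. \<sigma> (X t \<omega>) (Y t \<omega>)) \<and>
        ito_differential \<Omega> F B Y
          (\<lambda>t \<omega>. (1 / \<delta>) *\<^sub>R g (X t \<omega>) (Y t \<omega>)) (\<lambda>t \<omega>. (1 / sqrt \<delta>) *\<^sub>R a (X t \<omega>) (Y t \<omega>)) \<and>
        markov_with \<Omega> F (\<lambda>t \<omega>. (X t \<omega>, Y t \<omega>)) p \<nu>)"

definition invariant_measure ::
    "(real \<Rightarrow> 'e::topological_space \<Rightarrow> 'e measure) \<Rightarrow> 'e measure \<Rightarrow> bool" where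
  "invariant_measure q m \<longleftrightarrow> m \<in> prob_measures \<and> (\<forall>t\<ge>0. m \<bind> q t = m)"

definition unique_frozen_invariant_measure ::
    "'w itself \<Rightarrow> (real ^ 'n \<Rightarrow> real ^ 'd \<Rightarrow> real ^ 'd) \<Rightarrow> (real ^ 'n \<Rightarrow> real ^ 'd \<Rightarrow> real ^ 'd ^ 'd) \<Rightarrow>
      real ^ 'n \<Rightarrow> (real ^ 'd) measure \<Rightarrow> bool" where
  "unique_frozen_invariant_measure (w::'w itself) g a x m \<longleftrightarrow>
     (\<exists>q. sde_transition_function w (g x) (a x) q \<and>
        invariant_measure q m \<and> (\<forall>m'. invariant_measure q m' \<longrightarrow> m' = m))"

definition averaged ::
    "('x \<Rightarrow> 'y measure) \<Rightarrow> ('x \<Rightarrow> 'y \<Rightarrow> 'v::{banach, second_countable_topology}) \<Rightarrow> 'x \<Rightarrow> 'v" where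
  "averaged \<mu> f x = (\<integral>y. f x y \<partial>\<mu> x)"

text \<open>
  \<open>p \<delta>\<close>, \<open>\<delta> > 0\<close>, is the transition function of the slow-fast system and \<open>pbar\<close> that of the averaged
  process, \<open>\<mu> x\<close> being the invariant measure of the frozen process at \<open>x\<close>. Integrability is required
  because Bochner integrals of non-integrable functions are 0 by convention.
\<close>

definition slow_fast_averaging ::
    "'w itself \<Rightarrow>
      (real ^ 'n \<Rightarrow> real ^ 'd \<Rightarrow> real ^ 'n) \<Rightarrow> (real ^ 'n \<Rightarrow> real ^ 'd \<Rightarrow> real ^ 'n ^ 'n) \<Rightarrow>
      (real ^ 'n \<Rightarrow> real ^ 'd \<Rightarrow> real ^ 'd) \<Rightarrow> (real ^ 'n \<Rightarrow> real ^ 'd \<Rightarrow> real ^ 'd ^ 'd) \<Rightarrow>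
      (real ^ 'n \<Rightarrow> (real ^ 'd) measure) \<Rightarrow>
      (real \<Rightarrow> real \<Rightarrow> (real ^ 'n) \<times> (real ^ 'd) \<Rightarrow> ((real ^ 'n) \<times> (real ^ 'd)) measure) \<Rightarrow>
      (real \<Rightarrow> real ^ 'n \<Rightarrow> (real ^ 'n) measure) \<Rightarrow> bool" where
  "slow_fast_averaging (w::'w itself) b \<sigma> g a \<mu> p pbar \<longleftrightarrow>
     (\<forall>\<delta>>0. slow_fast_transition_function w b \<sigma> g a \<delta> (p \<delta>)) \<and>
     (\<forall>x. unique_frozen_invariant_measure w g a x (\<mu> x) \<and>
        integrable (\<mu> x) (b x) \<and> integrable (\<mu> x) (\<sigma> x)) \<and>
     sde_transition_function w (averaged \<mu> b) (averaged \<mu> \<sigma>) pbar"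

end

theory Submission
  imports Defs
begin

text \<open>
  Write a time \<open>t\<close> as \<open>s + k\<tau>\<close> with \<open>0 \<le> s \<le> \<tau>\<close>. Replacing the slow-fast dynamics by the averaged
  one on a single block of length at most \<open>\<tau>\<close> costs at most \<open>\<delta>\<^sup>\<alpha> \<^bold>C(\<nu>)\<close>, and an error made \<open>m\<close> blocks
  before \<open>t\<close> is damped by the contraction to at most \<open>C exp(-\<lambda>m\<tau>)\<close> times its size. Summing the
  geometric series over the blocks gives a bound independent of \<open>t\<close>.
\<close>

lemma transition_function_measurable:
  assumes "transition_function p" "t \<ge> 0"
  shows "p t \<in> borel \<rightarrow>\<^sub>M prob_algebra borel"
  using assms by (simp add: transition_function_def)

text \<open>Iterating over blocks restarts both dynamics from the laws reached so far; the metric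
  axioms and the contraction apply to these only once they are known to be probability
  measures.\<close>

lemma bind_transition_function_in_prob_measures:
  assumes "transition_function p" "t \<ge> 0" "\<nu> \<in> prob_measures"
  shows "\<nu> \<bind> p t \<in> prob_measures"
proof -
  \<comment> \<open>The bind rule used below concerns laws and kernels depending measurably on a
    parameter, so \<open>\<nu>\<close> and \<open>p t\<close> are made constant in a dummy real
    parameter, evaluated at 0 at the end.\<close>
  have "(\<lambda>_. \<nu>) \<in> borel \<rightarrow>\<^sub>M prob_algebra borel"
    using assms(3) by simp
  moreover have "(\<lambda>(_, y). p t y) \<in> borel \<Otimes>\<^sub>M borel \<rightarrow>\<^sub>M prob_algebra borel"
    using transition_function_measurable[OF assms(1,2)] by measurable
  ultimately have "(\<lambda>_::real. \<nu> \<bind> p t) \<in> borel \<rightarrow>\<^sub>M prob_algebra borel"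
    by (intro measurable_bind_prob_space2[where N = borel]) simp_all
  from measurable_space[OF this, of 0] show ?thesis by simp
qed

text \<open>Chapman-Kolmogorov is assumed for point masses only; associativity of the Giry bind
  carries it over to an arbitrary initial law.\<close>

lemma bind_transition_function_add:
  assumes p: "transition_function p" and st: "s \<ge> 0" "t \<ge> 0" and \<nu>: "\<nu> \<in> prob_measures"
  shows "\<nu> \<bind> p s \<bind> p t = \<nu> \<bind> p (s + t)"
proof -
  have sets: "sets \<nu> = sets borel" using \<nu> by (simp add: space_prob_algebra)
  have "p s \<in> \<nu> \<rightarrow>\<^sub>M subprob_algebra borel"
    using measurable_prob_algebraD[OF transition_function_measurable[OF p st(1)]]
    by (simp add: measurable_cong_sets[OF sets refl])
  then have "\<nu> \<bind> p s \<bind> p t = \<nu> \<bind> (\<lambda>z. p s z \<bind> p t)"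
    using measurable_prob_algebraD[OF transition_function_measurable[OF p st(2)]]
    by (rule bind_assoc)
  then show ?thesis
    using p st by (simp add: transition_function_def)
qed

lemma bind_transition_function_0:
  assumes "transition_function p" "\<nu> \<in> prob_measures"
  shows "\<nu> \<bind> p 0 = \<nu>"
proof -
  have "p 0 = return borel"
    using assms(1) by (auto simp: transition_function_def)
  then show ?thesis
    using assms(2) by (simp add: bind_return'' space_prob_algebra)
qed

lemma marginal_x_in_prob_measures:
  fixes \<nu> :: "('x::topological_space \<times> 'y::topological_space) measure"
  assumes "\<nu> \<in> prob_measures"
  shows "marginal_x \<nu> \<in> prob_measures"
proof -
  have "fst \<in> \<nu> \<rightarrow>\<^sub>M (borel :: 'x measure)"
    using assms borel_measurable_continuous_onI[OF continuous_on_fst[OF continuous_on_id]]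
    by (simp add: space_prob_algebra cong: measurable_cong_sets)
  then show ?thesis
    using assms
    by (auto simp: marginal_x_def space_prob_algebra intro: prob_space.prob_space_distr)
qed

lemma block_decomposition:
  fixes t \<tau> :: real
  assumes "t \<ge> 0" "\<tau> > 0"
  obtains k :: nat and s where "s \<in> {0..\<tau>}" "t = s + real k * \<tau>"
proof (rule that[of "t - real (nat \<lfloor>t / \<tau>\<rfloor>) * \<tau>" "nat \<lfloor>t / \<tau>\<rfloor>"])
  have "real (nat \<lfloor>t / \<tau>\<rfloor>) \<le> t / \<tau>" "t / \<tau> \<le> real (nat \<lfloor>t / \<tau>\<rfloor>) + 1"
    using assms by (simp, linarith)
  then show "t - real (nat \<lfloor>t / \<tau>\<rfloor>) * \<tau> \<in> {0..\<tau>}"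
    using assms(2) by (simp add: field_simps)
qed simp

text \<open>The finite sum is compared with the full geometric series, whose extra term at m = 0
  only loosens the bound.\<close>

lemma sum_powers_le:
  fixes r :: real
  assumes "0 \<le> r" "r < 1"
  shows "(\<Sum>m=1..k. r ^ m) \<le> 1 / (1 - r)"
proof -
  have "(\<Sum>m=1..k. r ^ m) \<le> (\<Sum>m. r ^ m)"
    using assms by (intro sum_le_suminf summable_geometric) auto
  then show ?thesis using assms by (simp add: suminf_geometric)
qed

text \<open>The hypothesis \<open>short\<close> is demanded only along the orbit of
  \<open>\<nu>\<close>, with one \<open>K\<close> for all restart times \<open>u\<close>. This is
  exactly what a bound on M uniform in time provides.\<close>

lemma averaging_error_le:
  fixes p :: "real \<Rightarrow> 'x \<times> 'y \<Rightarrow> ('x::topological_space \<times> 'y::topological_space) measure"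
    and pbar :: "real \<Rightarrow> 'x \<Rightarrow> 'x measure"
  assumes p: "transition_function p" and pbar: "transition_function pbar"
    and dst: "Metric_space prob_measures dst"
    and contr: "\<And>\<nu> \<eta> t. \<nu> \<in> prob_measures \<Longrightarrow> \<eta> \<in> prob_measures \<Longrightarrow> t > 0 \<Longrightarrow>
      dst (\<nu> \<bind> pbar t) (\<eta> \<bind> pbar t) \<le> C * exp (- lam * t) * dst \<nu> \<eta>"
    and "lam > 0" "\<tau> > 0"
    and \<nu>: "\<nu> \<in> prob_measures"
    and short: "\<And>u s. u \<ge> 0 \<Longrightarrow> s \<in> {0..\<tau>} \<Longrightarrow>
      dst (marginal_x (\<nu> \<bind> p u) \<bind> pbar s) (marginal_x (\<nu> \<bind> p u \<bind> p s)) \<le> K"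
    and "t \<ge> 0"
  shows "dst (marginal_x \<nu> \<bind> pbar t) (marginal_x (\<nu> \<bind> p t))
    \<le> K * (1 + \<bar>C\<bar> / (1 - exp (- lam * \<tau>)))"
proof -
  interpret Metric_space prob_measures dst by (rule dst)
  define r where "r = exp (- lam * \<tau>)"
  have r: "0 \<le> r" "r < 1"
    using \<open>lam > 0\<close> \<open>\<tau> > 0\<close> by (auto simp: r_def)
  \<comment> \<open>\<open>K\<close> dominates a distance, and u = s = 0 is always an admissible
    choice.\<close>
  have K: "K \<ge> 0"
    using short[of 0 0] \<open>\<tau> > 0\<close> by (intro order_trans[OF nonneg short[of 0 0]]) auto
  note prob = marginal_x_in_prob_measures bind_transition_function_in_prob_measures
  \<comment> \<open>The restart time \<open>u\<close> and the length \<open>s\<close> must vary in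
    the induction: peeling off the first block moves the start to u + s and makes the next first
    block a full one. The 1 is the undamped error of the last block, hence the sum starts at m =
    1.\<close>
  have blocks: "dst (marginal_x (\<nu> \<bind> p u) \<bind> pbar (s + real k * \<tau>))
      (marginal_x (\<nu> \<bind> p u \<bind> p (s + real k * \<tau>))) \<le> K * (1 + \<bar>C\<bar> * (\<Sum>m=1..k. r ^ m))"
    if "u \<ge> 0" "s \<in> {0..\<tau>}" for u s k
    using that
  proof (induction k arbitrary: u s)
    case 0
    then show ?case using short by simp
  next
    case (Suc k)
    define \<eta> where "\<eta> = \<nu> \<bind> p u"
    \<comment> \<open>\<open>T\<close> is the time left after the first block. It is positive even
      when s = 0, so the contraction can be applied over it.\<close>
    define T where "T = real (Suc k) * \<tau>"
    have s: "0 \<le> s" and T: "T > 0"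
      using Suc.prems \<open>\<tau> > 0\<close> by (auto simp: T_def)
    have \<eta>: "\<eta> \<in> prob_measures"
      unfolding \<eta>_def using Suc.prems p \<nu> by (intro prob)
    have \<eta>s: "\<eta> \<bind> p s \<in> prob_measures"
      using s p \<eta> by (intro prob)
    have early: "dst (marginal_x \<eta> \<bind> pbar s) (marginal_x (\<eta> \<bind> p s)) \<le> K"
      unfolding \<eta>_def using Suc.prems by (rule short)
    \<comment> \<open>First half of the triangle: the intermediate law runs the slow-fast system up
      to \<open>s\<close>, projects to the slow variable, then follows the averaged process. The
      error at time \<open>s\<close> is thus damped over k + 1 blocks.\<close>
    have "dst (marginal_x \<eta> \<bind> pbar (s + T)) (marginal_x (\<eta> \<bind> p s) \<bind> pbar T)
        = dst (marginal_x \<eta> \<bind> pbar s \<bind> pbar T) (marginal_x (\<eta> \<bind> p s) \<bind> pbar T)"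
      using s T \<eta> pbar by (simp add: bind_transition_function_add prob)
    also have "\<dots> \<le> C * exp (- lam * T) * dst (marginal_x \<eta> \<bind> pbar s) (marginal_x (\<eta> \<bind> p s))"
      using s T \<eta> \<eta>s pbar by (intro contr marginal_x_in_prob_measures
          bind_transition_function_in_prob_measures[OF pbar])
    \<comment> \<open>No sign is assumed for \<open>C\<close>; its absolute value makes the factor
      monotone in the distance.\<close>
    also have "\<dots> \<le> \<bar>C\<bar> * exp (- lam * T) * K"
      using early by (intro mult_mono mult_right_mono) auto
    also have "exp (- lam * T) = r ^ Suc k"
      unfolding r_def T_def by (simp only: exp_of_nat_mult[symmetric] ac_simps)
    finally have 1: "dst (marginal_x \<eta> \<bind> pbar (s + T)) (marginal_x (\<eta> \<bind> p s) \<bind> pbar T)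
      \<le> \<bar>C\<bar> * r ^ Suc k * K" .
    \<comment> \<open>Second half: the remaining time is read as \<tau> + k\<tau>, so the induction
      hypothesis is used with first block \<tau>. This is why the block length ranges over an
      interval closed at \<tau>.\<close>
    have "dst (marginal_x (\<nu> \<bind> p (u + s)) \<bind> pbar (\<tau> + real k * \<tau>))
        (marginal_x (\<nu> \<bind> p (u + s) \<bind> p (\<tau> + real k * \<tau>))) \<le> K * (1 + \<bar>C\<bar> * (\<Sum>m=1..k. r ^ m))"
      using Suc.prems \<open>\<tau> > 0\<close> by (intro Suc.IH) auto
    moreover have "\<nu> \<bind> p (u + s) = \<eta> \<bind> p s"
      unfolding \<eta>_def using Suc.prems s p \<nu> by (simp add: bind_transition_function_add)
    moreover have "\<eta> \<bind> p s \<bind> p T = \<eta> \<bind> p (s + T)"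
      using s T \<eta> p by (simp add: bind_transition_function_add)
    moreover have "\<tau> + real k * \<tau> = T"
      by (simp add: T_def algebra_simps)
    ultimately have 2: "dst (marginal_x (\<eta> \<bind> p s) \<bind> pbar T) (marginal_x (\<eta> \<bind> p (s + T)))
      \<le> K * (1 + \<bar>C\<bar> * (\<Sum>m=1..k. r ^ m))"
      by simp
    have "dst (marginal_x \<eta> \<bind> pbar (s + T)) (marginal_x (\<eta> \<bind> p (s + T)))
        \<le> dst (marginal_x \<eta> \<bind> pbar (s + T)) (marginal_x (\<eta> \<bind> p s) \<bind> pbar T)
          + dst (marginal_x (\<eta> \<bind> p s) \<bind> pbar T) (marginal_x (\<eta> \<bind> p (s + T)))"
      using s T p pbar \<eta> \<eta>s by (intro triangle prob) auto
    also have "\<dots> \<le> \<bar>C\<bar> * r ^ Suc k * K + K * (1 + \<bar>C\<bar> * (\<Sum>m=1..k. r ^ m))"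
      by (rule add_mono[OF 1 2])
    also have "\<dots> = K * (1 + \<bar>C\<bar> * (\<Sum>m=1..Suc k. r ^ m))"
      by (simp add: algebra_simps)
    finally show ?case by (simp only: \<eta>_def T_def)
  qed
  obtain k s where "s \<in> {0..\<tau>}" "t = s + real k * \<tau>"
    using block_decomposition \<open>t \<ge> 0\<close> \<open>\<tau> > 0\<close> by blast
  with blocks[of 0 s k] p \<nu> have
    "dst (marginal_x \<nu> \<bind> pbar t) (marginal_x (\<nu> \<bind> p t)) \<le> K * (1 + \<bar>C\<bar> * (\<Sum>m=1..k. r ^ m))"
    by (simp add: bind_transition_function_0)
  also have "\<dots> \<le> K * (1 + \<bar>C\<bar> * (1 / (1 - r)))"
    using K r by (intro mult_left_mono add_left_mono sum_powers_le) auto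
  finally show ?thesis by (simp add: r_def)
qed

theorem theorem2p1:
  shows "\<exists>Ctilde :: ((real ^ 'n) \<times> (real ^ 'd)) measure \<Rightarrow> real \<Rightarrow> real \<Rightarrow> real \<Rightarrow> real \<Rightarrow> real.
    \<forall>(b :: real ^ 'n \<Rightarrow> real ^ 'd \<Rightarrow> real ^ 'n) (\<sigma> :: real ^ 'n \<Rightarrow> real ^ 'd \<Rightarrow> real ^ 'n ^ 'n)
      (g :: real ^ 'n \<Rightarrow> real ^ 'd \<Rightarrow> real ^ 'd) (a :: real ^ 'n \<Rightarrow> real ^ 'd \<Rightarrow> real ^ 'd ^ 'd)
      (\<mu> :: real ^ 'n \<Rightarrow> (real ^ 'd) measure)
      (p :: real \<Rightarrow> real \<Rightarrow> (real ^ 'n) \<times> (real ^ 'd) \<Rightarrow> ((real ^ 'n) \<times> (real ^ 'd)) measure)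
      (pbar :: real \<Rightarrow> real ^ 'n \<Rightarrow> (real ^ 'n) measure)
      (dst :: (real ^ 'n) measure \<Rightarrow> (real ^ 'n) measure \<Rightarrow> real)
      (C :: real) (lam :: real) (\<tau> :: real) (\<alpha> :: real)
      (M :: ((real ^ 'n) \<times> (real ^ 'd)) measure \<Rightarrow> real)
      (Cb :: ((real ^ 'n) \<times> (real ^ 'd)) measure \<Rightarrow> real).
    slow_fast_averaging TYPE('w) b \<sigma> g a \<mu> p pbar \<longrightarrow>
    Metric_space prob_measures dst \<longrightarrow>
    lam > 0 \<longrightarrow>
    (\<forall>\<nu>\<in>prob_measures. \<forall>\<eta>\<in>prob_measures. \<forall>t>0.
       dst (\<nu> \<bind> pbar t) (\<eta> \<bind> pbar t) \<le> C * exp (- lam * t) * dst \<nu> \<eta>) \<longrightarrow>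
    \<tau> > 0 \<longrightarrow> \<alpha> > 0 \<longrightarrow>
    (\<forall>\<nu>\<in>prob_measures. M \<nu> \<ge> 0) \<longrightarrow>
    (\<forall>\<nu>\<in>prob_measures. \<forall>\<delta>>0.
       (SUP t\<in>{0..\<tau>}. ereal (dst (marginal_x \<nu> \<bind> pbar t) (marginal_x (\<nu> \<bind> p \<delta> t))))
         \<le> ereal (\<delta> powr \<alpha> * M \<nu>)) \<longrightarrow>
    (\<forall>\<nu>\<in>prob_measures. \<forall>\<delta>>0. (SUP t\<in>{0..}. ereal (M (\<nu> \<bind> p \<delta> t))) \<le> ereal (Cb \<nu>)) \<longrightarrow>
    (\<forall>\<nu>\<in>prob_measures.
       Ctilde \<nu> (Cb \<nu>) C lam \<tau> > 0 \<and>
       (\<forall>t\<ge>0. \<forall>\<delta>>0.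
          dst (marginal_x \<nu> \<bind> pbar t) (marginal_x (\<nu> \<bind> p \<delta> t))
            \<le> Ctilde \<nu> (Cb \<nu>) C lam \<tau> * \<delta> powr \<alpha>))"
\<comment> \<open>The witness is the factor of \<open>averaging_error_le\<close> for K =
  \<delta>^\<alpha> Cb(\<nu>), with \<delta>^\<alpha> split off. Raising Cb(\<nu>) by 1 keeps it
  strictly positive when Cb(\<nu>) = 0.\<close>
proof (intro exI[of _ "\<lambda>_ c C lam \<tau>. (c + 1) * (1 + \<bar>C\<bar> / (1 - exp (- lam * \<tau>)))"]
    allI impI ballI, goal_cases)
  case (1 b \<sigma> g a \<mu> p pbar dst C lam \<tau> \<alpha> M Cb \<nu>)
  have pbar: "transition_function pbar" and p: "transition_function (p \<delta>)" if "\<delta> > 0" for \<delta>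
    using 1(1) that
    by (auto simp: slow_fast_averaging_def slow_fast_transition_function_def
        sde_transition_function_def)
  \<comment> \<open>The suprema are taken in \<open>ereal\<close>, a complete lattice, so bounding
    them amounts to bounding every member of the family.\<close>
  have short: "dst (marginal_x \<eta> \<bind> pbar s) (marginal_x (\<eta> \<bind> p \<delta> s)) \<le> \<delta> powr \<alpha> * M \<eta>"
    if "\<eta> \<in> prob_measures" "\<delta> > 0" "s \<in> {0..\<tau>}" for \<eta> \<delta> s
    using 1(8) that by (auto simp: SUP_le_iff)
  have M_le: "M (\<nu> \<bind> p \<delta> u) \<le> Cb \<nu>" if "\<delta> > 0" "u \<ge> 0" for \<delta> u
    using 1(9,10) that by (auto simp: SUP_le_iff)
  \<comment> \<open>Nonnegativity of Cb(\<nu>) follows from any single value of M on the orbit;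
    \<delta> = 1 at time 0 is an arbitrary choice.\<close>
  have "0 \<le> M (\<nu> \<bind> p 1 0)"
    using 1(7,10) p by (simp add: bind_transition_function_in_prob_measures)
  also have "\<dots> \<le> Cb \<nu>" by (rule M_le) auto
  finally have Cb: "0 \<le> Cb \<nu>" .
  have factor: "1 + \<bar>C\<bar> / (1 - exp (- lam * \<tau>)) > 0"
    using 1(3,5) by (intro add_pos_nonneg divide_nonneg_nonneg) auto
  have "dst (marginal_x \<nu> \<bind> pbar t) (marginal_x (\<nu> \<bind> p \<delta> t))
      \<le> (Cb \<nu> + 1) * (1 + \<bar>C\<bar> / (1 - exp (- lam * \<tau>))) * \<delta> powr \<alpha>"
    if "t \<ge> 0" "\<delta> > 0" for t \<delta>
  proof -
    have "dst (marginal_x \<nu> \<bind> pbar t) (marginal_x (\<nu> \<bind> p \<delta> t))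
        \<le> \<delta> powr \<alpha> * Cb \<nu> * (1 + \<bar>C\<bar> / (1 - exp (- lam * \<tau>)))"
    proof (rule averaging_error_le[OF p pbar 1(2) _ 1(3,5,10) _ \<open>t \<ge> 0\<close>])
      fix u s :: real assume u: "u \<ge> 0" and s: "s \<in> {0..\<tau>}"
      have "dst (marginal_x (\<nu> \<bind> p \<delta> u) \<bind> pbar s) (marginal_x (\<nu> \<bind> p \<delta> u \<bind> p \<delta> s))
          \<le> \<delta> powr \<alpha> * M (\<nu> \<bind> p \<delta> u)"
        using u s \<open>\<delta> > 0\<close> p 1(10) by (intro short bind_transition_function_in_prob_measures)
      also have "\<dots> \<le> \<delta> powr \<alpha> * Cb \<nu>"
        using M_le u \<open>\<delta> > 0\<close> by (intro mult_left_mono) auto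
      finally show "dst (marginal_x (\<nu> \<bind> p \<delta> u) \<bind> pbar s)
        (marginal_x (\<nu> \<bind> p \<delta> u \<bind> p \<delta> s)) \<le> \<delta> powr \<alpha> * Cb \<nu>" .
    qed (use 1(4) \<open>\<delta> > 0\<close> in auto)
    also have "\<dots> \<le> \<delta> powr \<alpha> * (Cb \<nu> + 1) * (1 + \<bar>C\<bar> / (1 - exp (- lam * \<tau>)))"
      using factor by (intro mult_right_mono mult_left_mono) auto
    finally show ?thesis by (simp only: ac_simps)
  qed
  then show ?case using Cb factor by simp
qed

end
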